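(* Let $G$ be a countable weakly branch group acting on a spherically homogeneous rooted tree $T$. Then the centralizer of $G$ in the group $\mathrm{Bij}(\partial T)$ of all bijections of the boundary $\partial T$ onto itself is trivial.
   Context: A rooted tree is an infinite tree $T$ with vertex set divided into levels $V_n$, $n\in\mathbb{Z}_{\geq 0}$, such that $V_0=\{v_0\}$ consists of one vertex (the root), edges join only consecutive levels, and each vertex of $V_n$ ($n\geq 1$) is joined to exactly one vertex of $V_{n-1}$. $T$ is spherically homogeneous if, for each $n$, every vertex of $V_n$ is joined to the same finite number $d_n\geq 1$ of vertices of $V_{n+1}$. $\mathrm{Aut}(T)$ is the group of graph automorphisms of $T$ fixing the root. The boundary $\partial T$ is the set of infinite paths starting at $v_0$ and passing through each level exactly once; $\mathrm{Aut}(T)$ acts naturally (and faithfully for weakly branch groups) on it, so that $G$ is regarded as a subgroup of $\mathrm{Bij}(\partial T)$. For a vertex $v$, $T_v$ is the subtree emerging from $v$ (all descendants of $v$, including $v$). A subgroup $G<\mathrm{Aut}(T)$ is weakly branch if it acts transitively on each level $V_n$ and, for every vertex $v$, the rigid stabilizer $\mathrm{rist}_v(G)$, i.e. the subgroup of all $g\in G$ fixing every vertex outside $T_v$, is nontrivial. The centralizer of a subgroup $G$ in a group $H$ is $C_H(G)=\{h\in H: hg=gh \text{ for all } g\in G\}$. *)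

theory Defs
  imports "HOL-Algebra.Algebra" "HOL-Library.Countable_Set"
begin

section \<open>Rooted trees\<close>

record 'v levelled_graph =
  level :: "nat \<Rightarrow> 'v set"
  edges :: "'v set set"
  root :: 'v

definition vertices :: "'v levelled_graph \<Rightarrow> 'v set"
  where "vertices T = (\<Union>n. level T n)"

text \<open>Connectedness and the absence of cycles are consequences of the last two conditions.\<close>

definition rooted_tree :: "'v levelled_graph \<Rightarrow> bool"
  where "rooted_tree T \<longleftrightarrow>
    infinite (vertices T) \<and>
    disjoint_family (level T) \<and>
    level T 0 = {root T} \<and>
    (\<forall>e\<in>edges T. \<exists>n. \<exists>v\<in>level T n. \<exists>w\<in>level T (Suc n). e = {v, w}) \<and>
    (\<forall>n. \<forall>w\<in>level T (Suc n). \<exists>!v. v \<in> level T n \<and> {v, w} \<in> edges T)"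

definition spherically_homogeneous :: "'v levelled_graph \<Rightarrow> bool"
  where "spherically_homogeneous T \<longleftrightarrow>
    (\<exists>d :: nat \<Rightarrow> nat. \<forall>n. d n \<ge> 1 \<and>
      (\<forall>v\<in>level T n.
        finite {w \<in> level T (Suc n). {v, w} \<in> edges T} \<and>
        card {w \<in> level T (Suc n). {v, w} \<in> edges T} = d n))"

definition child_rel :: "'v levelled_graph \<Rightarrow> ('v \<times> 'v) set"
  where "child_rel T =
    {(v, w). \<exists>n. v \<in> level T n \<and> w \<in> level T (Suc n) \<and> {v, w} \<in> edges T}"

text \<open>The vertex set of the subtree \<open>T\<^sub>v\<close>.\<close>

definition subtree :: "'v levelled_graph \<Rightarrow> 'v \<Rightarrow> 'v set"
  where "subtree T v = {w. (v, w) \<in> (child_rel T)\<^sup>*}"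


section \<open>Automorphisms and weakly branch groups\<close>

text \<open>Automorphisms are normalised to be \<^const>\<open>undefined\<close> off the vertex set, as in
  \<^const>\<open>BijGroup\<close>; multiplication is composition of maps.\<close>

definition tree_automorphisms :: "'v levelled_graph \<Rightarrow> ('v \<Rightarrow> 'v) set"
  where "tree_automorphisms T =
    {g \<in> Bij (vertices T). g (root T) = root T \<and>
      (\<forall>v\<in>vertices T. \<forall>w\<in>vertices T. {g v, g w} \<in> edges T \<longleftrightarrow> {v, w} \<in> edges T)}"

definition Aut_tree :: "'v levelled_graph \<Rightarrow> ('v \<Rightarrow> 'v) monoid"
  where "Aut_tree T = BijGroup (vertices T) \<lparr>carrier := tree_automorphisms T\<rparr>"

lemma group_Aut_tree:
  assumes "rooted_tree T"
  shows "group (Aut_tree T)"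
proof -
  interpret B: group "BijGroup (vertices T)" by (rule group_BijGroup)
  have r: "root T \<in> vertices T"
    using assms by (auto simp: rooted_tree_def vertices_def)
  have "subgroup (tree_automorphisms T) (BijGroup (vertices T))"
  proof (rule B.subgroupI)
    show "tree_automorphisms T \<subseteq> carrier (BijGroup (vertices T))"
      by (auto simp: tree_automorphisms_def BijGroup_def)
    have "(\<lambda>x\<in>vertices T. x) \<in> tree_automorphisms T"
      using r id_Bij by (auto simp: tree_automorphisms_def)
    then show "tree_automorphisms T \<noteq> {}" by blast
  next
    fix g assume g: "g \<in> tree_automorphisms T"
    then have gB: "g \<in> Bij (vertices T)" by (simp add: tree_automorphisms_def)
    then have bij: "bij_betw g (vertices T) (vertices T)" by (simp add: Bij_def)
    let ?h = "inv_into (vertices T) g"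
    have mem: "?h x \<in> vertices T" and gh: "g (?h x) = x" if "x \<in> vertices T" for x
      using that gB bij by (auto simp: Bij_inv_into_mem bij_betw_inv_into_right)
    have "g (root T) = root T" using g by (simp add: tree_automorphisms_def)
    then have "?h (root T) = root T"
      using bij_betw_inv_into_left[OF bij r] by simp
    moreover have "{?h v, ?h w} \<in> edges T \<longleftrightarrow> {v, w} \<in> edges T"
      if "v \<in> vertices T" "w \<in> vertices T" for v w
    proof -
      have "{g (?h v), g (?h w)} \<in> edges T \<longleftrightarrow> {?h v, ?h w} \<in> edges T"
        using g mem that by (simp add: tree_automorphisms_def)
      then show ?thesis by (simp add: gh that)
    qed
    ultimately have "(\<lambda>x\<in>vertices T. ?h x) \<in> tree_automorphisms T"
      using r restrict_inv_into_Bij[OF gB] by (simp add: tree_automorphisms_def)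
    then show "inv\<^bsub>BijGroup (vertices T)\<^esub> g \<in> tree_automorphisms T"
      using gB by (simp add: inv_BijGroup)
  next
    fix g h assume g: "g \<in> tree_automorphisms T" and h: "h \<in> tree_automorphisms T"
    then have B: "g \<in> Bij (vertices T)" "h \<in> Bij (vertices T)"
      by (auto simp: tree_automorphisms_def)
    have "h x \<in> vertices T" if "x \<in> vertices T" for x
      using B(2) that Bij_imp_funcset by blast
    then have "compose (vertices T) g h \<in> tree_automorphisms T"
      using g h r compose_Bij[OF B] by (simp add: tree_automorphisms_def compose_eq)
    then show "g \<otimes>\<^bsub>BijGroup (vertices T)\<^esub> h \<in> tree_automorphisms T"
      using B by (simp add: BijGroup_def)
  qed
  then show ?thesis
    unfolding Aut_tree_def by (rule B.subgroup_imp_group)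
qed

definition level_transitive :: "'v levelled_graph \<Rightarrow> ('v \<Rightarrow> 'v) set \<Rightarrow> bool"
  where "level_transitive T G \<longleftrightarrow>
    (\<forall>n. \<forall>v\<in>level T n. \<forall>w\<in>level T n. \<exists>g\<in>G. g v = w)"

definition rigid_stabilizer :: "'v levelled_graph \<Rightarrow> ('v \<Rightarrow> 'v) set \<Rightarrow> 'v \<Rightarrow> ('v \<Rightarrow> 'v) set"
  where "rigid_stabilizer T G v = {g \<in> G. \<forall>w\<in>vertices T - subtree T v. g w = w}"

definition weakly_branch :: "'v levelled_graph \<Rightarrow> ('v \<Rightarrow> 'v) set \<Rightarrow> bool"
  where "weakly_branch T G \<longleftrightarrow>
    subgroup G (Aut_tree T) \<and>
    level_transitive T G \<and>
    (\<forall>v\<in>vertices T. rigid_stabilizer T G v \<noteq> {\<one>\<^bsub>Aut_tree T\<^esub>})"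


section \<open>The boundary\<close>

definition boundary :: "'v levelled_graph \<Rightarrow> (nat \<Rightarrow> 'v) set"
  where "boundary T =
    {p. p 0 = root T \<and> (\<forall>k. {p k, p (Suc k)} \<in> edges T) \<and> (\<forall>n. \<exists>!k. p k \<in> level T n)}"

definition boundary_action :: "'v levelled_graph \<Rightarrow> ('v \<Rightarrow> 'v) \<Rightarrow> (nat \<Rightarrow> 'v) \<Rightarrow> (nat \<Rightarrow> 'v)"
  where "boundary_action T g = (\<lambda>p\<in>boundary T. g \<circ> p)"


section \<open>Centralizers\<close>

definition centralizer :: "('a, 'b) monoid_scheme \<Rightarrow> 'a set \<Rightarrow> 'a set"
  where "centralizer H G = {h \<in> carrier H. \<forall>g\<in>G. h \<otimes>\<^bsub>H\<^esub> g = g \<otimes>\<^bsub>H\<^esub> h}"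

end

theory Submission
  imports Defs
begin

text \<open>Let \<open>f\<close> centralize \<open>G\<close> and suppose that \<open>f\<close> moves a boundary point \<open>x\<close> to \<open>y \<noteq> x\<close>. Choose
  \<open>n\<close> with \<open>x n \<noteq> y n\<close> and put \<open>v = y n\<close>. Any vertex \<open>w\<close> of the subtree at \<open>v\<close> lies on the path
  \<open>h \<circ> y\<close> for some \<open>h \<in> G\<close>, and this path then passes through \<open>v\<close>, whereas \<open>h \<circ> x\<close> avoids the
  subtree. So the rigid stabilizer of \<open>v\<close> fixes \<open>h \<circ> x\<close>, hence also \<open>f (h \<circ> x) = h \<circ> y\<close>, and in
  particular \<open>w\<close>. Thus the rigid stabilizer of \<open>v\<close> is trivial, a contradiction.\<close>

lemma level_unique:
  assumes "rooted_tree T" "v \<in> level T m" "v \<in> level T n"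
  shows "m = n"
proof (rule ccontr)
  assume "m \<noteq> n"
  then have "level T m \<inter> level T n = {}"
    using assms(1) by (simp add: rooted_tree_def disjoint_family_on_def)
  then show False using assms by blast
qed

lemma unique_parent:
  assumes "rooted_tree T" "w \<in> level T (Suc n)"
  shows "\<exists>!v. v \<in> level T n \<and> {v, w} \<in> edges T"
  using assms by (simp add: rooted_tree_def)

lemma parent_unique:
  assumes "rooted_tree T" "w \<in> level T (Suc n)"
    and "u \<in> level T n" "{u, w} \<in> edges T" "v \<in> level T n" "{v, w} \<in> edges T"
  shows "u = v"
  using unique_parent[OF assms(1,2)] assms by blast

lemma parent_exists:
  assumes "rooted_tree T" "w \<in> level T (Suc n)"
  obtains v where "v \<in> level T n" "{v, w} \<in> edges T"
  using unique_parent[OF assms] by blast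

text \<open>Edges are unordered pairs, so \<open>v\<close> may be either the upper or the lower end;
  disjointness of the levels then ties the level of that end to \<open>n\<close>.\<close>

lemma adjacent_level:
  assumes T: "rooted_tree T" and e: "{v, w} \<in> edges T" and v: "v \<in> level T n"
  shows "w \<in> level T (Suc n) \<or> (\<exists>m. n = Suc m \<and> w \<in> level T m)"
proof -
  have "\<forall>e\<in>edges T. \<exists>n. \<exists>a\<in>level T n. \<exists>b\<in>level T (Suc n). e = {a, b}"
    using T by (simp add: rooted_tree_def)
  from bspec[OF this e]
  obtain k a b where ab: "a \<in> level T k" "b \<in> level T (Suc k)" "{v, w} = {a, b}"
    by (elim exE bexE)
  then consider "v = a" "w = b" | "v = b" "w = a" by (auto simp: doubleton_eq_iff)
  then show ?thesis
  proof cases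
    case 1
    with ab level_unique[OF T v, of k] show ?thesis by auto
  next
    case 2
    with ab level_unique[OF T v, of "Suc k"] show ?thesis by auto
  qed
qed

lemma vertices_level: "v \<in> level T n \<Longrightarrow> v \<in> vertices T"
  by (auto simp: vertices_def)

text \<open>Strong induction on the level. If \<open>u\<close> is the parent of \<open>v\<close>,
  then \<open>g v\<close> is adjacent to \<open>g u\<close>, so only a step back towards the root
  has to be excluded. Such a step would make \<open>g v\<close> the parent of \<open>g u\<close>;
  but that parent is \<open>g t\<close> for the parent \<open>t\<close> of \<open>u\<close>, and
  \<open>t\<close> and \<open>v\<close> lie on different levels, contrary to injectivity.\<close>

lemma automorphism_level:
  assumes T: "rooted_tree T" and g: "g \<in> tree_automorphisms T" and "v \<in> level T n"
  shows "g v \<in> level T n"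
  using \<open>v \<in> level T n\<close>
proof (induction n arbitrary: v rule: less_induct)
  case (less n)
  have inj: "inj_on g (vertices T)"
    using g by (auto simp: tree_automorphisms_def Bij_def bij_betw_def)
  have edge: "{g a, g b} \<in> edges T" if "{a, b} \<in> edges T" "a \<in> level T i" "b \<in> level T j" for a b i j
    using g that vertices_level by (fastforce simp: tree_automorphisms_def)
  show ?case
  proof (cases n)
    case 0
    then show ?thesis
      using less.prems T g by (auto simp: rooted_tree_def tree_automorphisms_def)
  next
    case (Suc k)
    obtain u where u: "u \<in> level T k" "{u, v} \<in> edges T"
      using parent_exists[OF T] less.prems Suc by blast
    have gu: "g u \<in> level T k" using less.IH u Suc by simp
    have guv: "{g u, g v} \<in> edges T" using edge u less.prems by blast
    have False if j: "k = Suc j" "g v \<in> level T j" for j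
    proof -
      obtain t where t: "t \<in> level T j" "{t, u} \<in> edges T"
        using parent_exists[OF T] u j by blast
      have "g t \<in> level T j" using less.IH t Suc j by simp
      moreover have "{g t, g u} \<in> edges T" using edge t u by blast
      moreover have "g u \<in> level T (Suc j)" "{g v, g u} \<in> edges T"
        using gu guv j by (simp_all add: insert_commute)
      ultimately have "g t = g v"
        using parent_unique[OF T, of "g u" j "g t" "g v"] j by blast
      moreover have "t \<in> vertices T" "v \<in> vertices T"
        using t less.prems by (auto intro: vertices_level)
      ultimately have "t = v"
        using inj by (simp add: inj_on_eq_iff)
      then show False using level_unique[OF T, of v j n] t less.prems Suc j by simp
    qed
    then show ?thesis using adjacent_level[OF T guv gu] Suc by blast
  qed
qed

text \<open>A path that meets each level exactly once can never turn back: a step towards the root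
  would revisit a level already met at an earlier index. Hence the index of a vertex on the path is
  its level.\<close>

lemma boundary_iff:
  assumes T: "rooted_tree T"
  shows "p \<in> boundary T \<longleftrightarrow> (\<forall>k. p k \<in> level T k \<and> {p k, p (Suc k)} \<in> edges T)"
proof
  assume p: "p \<in> boundary T"
  have "p k \<in> level T k" for k
  proof (induction k rule: less_induct)
    case (less k)
    show ?case
    proof (cases k)
      case 0
      then show ?thesis using p T by (auto simp: boundary_def rooted_tree_def)
    next
      case (Suc j)
      have "False" if "j = Suc m" "p k \<in> level T m" for m
      proof -
        have "p m \<in> level T m" using less that Suc by simp
        moreover have "\<exists>!i. p i \<in> level T m" using p by (auto simp: boundary_def)
        ultimately have "k = m" using that by blast
        then show False using that Suc by simp
      qed
      moreover have "{p j, p k} \<in> edges T" using p Suc by (auto simp: boundary_def)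
      ultimately show ?thesis using adjacent_level[OF T, of "p j" "p k" j] less Suc by blast
    qed
  qed
  then show "\<forall>k. p k \<in> level T k \<and> {p k, p (Suc k)} \<in> edges T"
    using p by (auto simp: boundary_def)
next
  assume p: "\<forall>k. p k \<in> level T k \<and> {p k, p (Suc k)} \<in> edges T"
  then have "p 0 \<in> level T 0" by blast
  then have "p 0 = root T" using T by (simp add: rooted_tree_def)
  moreover have "\<exists>!k. p k \<in> level T n" for n
    using p by (intro ex1I[of _ n]) (auto intro: level_unique[OF T])
  ultimately show "p \<in> boundary T"
    using p by (simp add: boundary_def)
qed

text \<open>Parents are unique, so climbing from a vertex of \<open>p\<close> towards the root never
  leaves \<open>p\<close>. Every ancestor of \<open>p k\<close> is thus on \<open>p\<close>, at the
  index given by its level.\<close>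

lemma boundary_meets_subtree:
  assumes T: "rooted_tree T" and p: "p \<in> boundary T"
    and v: "v \<in> level T n" and w: "p k \<in> subtree T v"
  shows "v = p n"
proof -
  note pl = p[unfolded boundary_iff[OF T], rule_format]
  \<comment> \<open>The index is quantified inside the claim because the induction step passes from
    index \<open>Suc j\<close> of a child to index \<open>j\<close> of its parent.\<close>
  have "\<forall>k. w = p k \<longrightarrow> (\<exists>m. v = p m)" if "(v, w) \<in> (child_rel T)\<^sup>*" for w
    using that
  proof (induction rule: rtrancl_induct)
    case (step u w)
    show ?case
    proof (intro allI impI)
      fix k assume k: "w = p k"
      obtain j where j: "u \<in> level T j" "w \<in> level T (Suc j)" "{u, w} \<in> edges T"
        using step by (auto simp: child_rel_def)
      then have "k = Suc j" using level_unique[OF T, of w k "Suc j"] pl k by simp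
      then have "u = p j"
        using parent_unique[OF T j(2,1,3), of "p j"] pl[of j] k by simp
      then show "\<exists>m. v = p m" using step by blast
    qed
  qed auto
  then obtain m where "v = p m" using w by (auto simp: subtree_def)
  then show ?thesis using level_unique[OF T v, of m] pl[of m] by simp
qed

lemma automorphism_comp_boundary:
  assumes T: "rooted_tree T" and g: "g \<in> tree_automorphisms T" and p: "p \<in> boundary T"
  shows "g \<circ> p \<in> boundary T"
proof -
  note pl = p[unfolded boundary_iff[OF T], rule_format]
  have "{g (p k), g (p (Suc k))} \<in> edges T" for k
    using g pl[of k] pl[of "Suc k"] vertices_level by (fastforce simp: tree_automorphisms_def)
  then show ?thesis
    using automorphism_level[OF T g] pl by (simp add: boundary_iff[OF T])
qed

text \<open>Composition with the inverse of \<open>g\<close> in \<open>Aut_tree T\<close> undoes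
  composition with \<open>g\<close>. The product of \<open>BijGroup\<close> unfolds to
  \<open>compose\<close> only for members of \<open>Bij\<close>, so this is needed before
  commutation can be read pointwise.\<close>

lemma boundary_action_Bij:
  assumes T: "rooted_tree T" and g: "g \<in> tree_automorphisms T"
  shows "boundary_action T g \<in> Bij (boundary T)"
proof -
  interpret A: group "Aut_tree T" using T by (rule group_Aut_tree)
  define h where "h = inv\<^bsub>Aut_tree T\<^esub> g"
  have gc: "g \<in> carrier (Aut_tree T)" using g by (simp add: Aut_tree_def)
  then have h: "h \<in> tree_automorphisms T"
    using A.inv_closed by (simp add: h_def Aut_tree_def)
  have B: "g \<in> Bij (vertices T)" "h \<in> Bij (vertices T)"
    using g h by (auto simp: tree_automorphisms_def)
  have "compose (vertices T) g h = (\<lambda>v\<in>vertices T. v)" "compose (vertices T) h g = (\<lambda>v\<in>vertices T. v)"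
    using A.r_inv[OF gc, folded h_def] A.l_inv[OF gc, folded h_def] B
    by (simp_all add: Aut_tree_def BijGroup_def)
  then have gh: "g (h v) = v" and hg: "h (g v) = v" if "v \<in> vertices T" for v
    using that by (metis compose_eq restrict_apply)+
  have pv: "p k \<in> vertices T" if "p \<in> boundary T" for p k
    using that by (auto simp: boundary_iff[OF T] intro: vertices_level)
  have "bij_betw (\<lambda>p. g \<circ> p) (boundary T) (boundary T)"
    by (rule bij_betw_byWitness[where f' = "\<lambda>p. h \<circ> p"])
      (simp_all add: image_subset_iff fun_eq_iff gh hg pv automorphism_comp_boundary[OF T] g h)
  then show ?thesis
    by (simp add: Bij_def boundary_action_def)
qed

theorem theorem2:
  fixes T :: "'v levelled_graph" and G :: "('v \<Rightarrow> 'v) set"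
  assumes "rooted_tree T" and "spherically_homogeneous T"
    and "weakly_branch T G" and "countable G"
  shows "centralizer (BijGroup (boundary T)) (boundary_action T ` G) = {\<one>\<^bsub>BijGroup (boundary T)\<^esub>}"
proof -
  note T = assms(1)
  interpret A: group "Aut_tree T" using T by (rule group_Aut_tree)
  interpret B: group "BijGroup (boundary T)" by (rule group_BijGroup)
  have sub: "subgroup G (Aut_tree T)" and trans: "level_transitive T G"
    and rist: "\<And>v. v \<in> vertices T \<Longrightarrow> rigid_stabilizer T G v \<noteq> {\<one>\<^bsub>Aut_tree T\<^esub>}"
    using assms(3) by (auto simp: weakly_branch_def)
  have aut: "g \<in> tree_automorphisms T" if "g \<in> G" for g
    using subgroup.subset[OF sub] that by (auto simp: Aut_tree_def)
  have one: "\<one>\<^bsub>Aut_tree T\<^esub> = (\<lambda>v\<in>vertices T. v)"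
    by (simp add: Aut_tree_def BijGroup_def)
  have act: "boundary_action T g \<in> carrier (BijGroup (boundary T))" if "g \<in> G" for g
    using boundary_action_Bij[OF T aut[OF that]] by (simp add: BijGroup_def)
  show ?thesis
  proof (intro equalityI subsetI)
    fix f assume "f \<in> {\<one>\<^bsub>BijGroup (boundary T)\<^esub>}"
    then show "f \<in> centralizer (BijGroup (boundary T)) (boundary_action T ` G)"
      using act by (auto simp: centralizer_def)
  next
    fix f assume f: "f \<in> centralizer (BijGroup (boundary T)) (boundary_action T ` G)"
    then have fB: "f \<in> Bij (boundary T)" by (simp add: centralizer_def BijGroup_def)
    then have fb: "f p \<in> boundary T" if "p \<in> boundary T" for p
      using that Bij_imp_funcset by blast
    have comm: "f (g \<circ> p) = g \<circ> f p" if g: "g \<in> G" and p: "p \<in> boundary T" for g p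
    proof -
      have "f \<otimes>\<^bsub>BijGroup (boundary T)\<^esub> boundary_action T g
          = boundary_action T g \<otimes>\<^bsub>BijGroup (boundary T)\<^esub> f"
        using f g by (auto simp: centralizer_def)
      then have "compose (boundary T) f (boundary_action T g) p
          = compose (boundary T) (boundary_action T g) f p"
        using fB act[OF g] by (simp add: BijGroup_def)
      then show ?thesis using p fb by (simp add: compose_eq boundary_action_def)
    qed
    have "f x = x" if x: "x \<in> boundary T" for x
    proof (rule ccontr)
      assume "f x \<noteq> x"
      define y where "y = f x"
      have y: "y \<in> boundary T" using fb x by (simp add: y_def)
      obtain n where n: "x n \<noteq> y n" using \<open>f x \<noteq> x\<close> unfolding y_def by (metis ext)
      define v where "v = y n"
      have vn: "v \<in> level T n" using y by (simp add: v_def boundary_iff[OF T])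
      have "g = \<one>\<^bsub>Aut_tree T\<^esub>" if g: "g \<in> rigid_stabilizer T G v" for g
      proof -
        have gG: "g \<in> G" using g by (simp add: rigid_stabilizer_def)
        have "g w = w" if w: "w \<in> vertices T" for w
        proof (cases "w \<in> subtree T v")
          case False
          then show ?thesis using g w by (simp add: rigid_stabilizer_def)
        next
          case True
          obtain m where m: "w \<in> level T m" using w by (auto simp: vertices_def)
          have "y m \<in> level T m" using y by (simp add: boundary_iff[OF T])
          \<comment> \<open>Transitivity is applied on the level \<open>m\<close> of
            \<open>w\<close>, not on the level \<open>n\<close> of \<open>v\<close>; in general
            \<open>h\<close> need not fix \<open>v\<close>.\<close>
          then obtain h where h: "h \<in> G" "h (y m) = w"
            using trans m unfolding level_transitive_def by blast
          have hx: "h \<circ> x \<in> boundary T" and hy: "h \<circ> y \<in> boundary T"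
            using automorphism_comp_boundary[OF T aut[OF h(1)]] x y by auto
          \<comment> \<open>The path \<open>h \<circ> y\<close> meets the subtree at
            \<open>w\<close>, its vertex of index \<open>m\<close>, so its vertex of index
            \<open>n\<close> must be \<open>v\<close>.\<close>
          have "v = h (y n)"
            using boundary_meets_subtree[OF T hy vn, of m] True h by simp
          moreover have "h (x n) \<noteq> h (y n)"
          proof -
            have "inj_on h (vertices T)"
              using aut[OF h(1)] by (auto simp: tree_automorphisms_def Bij_def bij_betw_def)
            moreover have "x n \<in> vertices T" "y n \<in> vertices T"
              using x y by (auto simp: boundary_iff[OF T] intro: vertices_level)
            ultimately show ?thesis using n by (auto dest: inj_onD)
          qed
          \<comment> \<open>A path entering the subtree would have \<open>v\<close> at index
            \<open>n\<close>, but \<open>h \<circ> x\<close> has \<open>h (x n)\<close>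
            there.\<close>
          ultimately have "h (x k) \<notin> subtree T v" for k
            using boundary_meets_subtree[OF T hx vn, of k] by auto
          moreover have "h (x k) \<in> vertices T" for k
            using hx by (auto simp: boundary_iff[OF T] intro: vertices_level)
          ultimately have "g \<circ> (h \<circ> x) = h \<circ> x"
            using g by (auto simp: rigid_stabilizer_def)
          \<comment> \<open>The centralizing property is used twice: with \<open>g\<close> here, to
            carry the fixed point over to its image under \<open>f\<close>, and with
            \<open>h\<close> next, to identify that image as \<open>h \<circ> y\<close>.\<close>
          then have "g \<circ> f (h \<circ> x) = f (h \<circ> x)"
            using comm[OF gG hx] by simp
          then have "g \<circ> (h \<circ> y) = h \<circ> y"
            using comm[OF h(1) x] by (simp add: y_def)
          then have "(g \<circ> (h \<circ> y)) m = (h \<circ> y) m" by (rule fun_cong)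
          then show ?thesis using h(2) by simp
        qed
        moreover have "g \<in> extensional (vertices T)"
          using aut[OF gG] by (simp add: tree_automorphisms_def Bij_def)
        ultimately show ?thesis
          unfolding one by (intro extensionalityI[of _ "vertices T"]) auto
      qed
      \<comment> \<open>Nontriviality is stated as being different from the singleton of the
        identity, so the identity must also be shown to belong to the rigid stabilizer.\<close>
      moreover have "\<one>\<^bsub>Aut_tree T\<^esub> \<in> rigid_stabilizer T G v"
        using subgroup.one_closed[OF sub] by (auto simp: rigid_stabilizer_def one)
      ultimately show False using rist[OF vertices_level[OF vn]] by blast
    qed
    moreover have "f \<in> extensional (boundary T)" using fB by (simp add: Bij_def)
    ultimately have "f = (\<lambda>p\<in>boundary T. p)"
      by (intro extensionalityI[of _ "boundary T"]) auto
    then show "f \<in> {\<one>\<^bsub>BijGroup (boundary T)\<^esub>}" by (simp add: BijGroup_def)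
  qed
qed

end
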